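(* Let $k=\mathbb{Q}[y,y^{-1}]$ and let $V$ be the free $k$-module with basis $e_1,e_2$. Let $R:V\otimes V\to V\otimes V$ be the $k$-linear map whose matrix with respect to the ordered basis $e_1\otimes e_1,\ e_1\otimes e_2,\ e_2\otimes e_1,\ e_2\otimes e_2$ is $$\begin{pmatrix}1&0&0&0\\0&1-y^2&1&0\\0&y^2&0&0\\0&0&0&1\end{pmatrix}.$$ Then $R$ satisfies the Yang-Baxter equation: as maps $V^{\otimes 3}\to V^{\otimes 3}$, $$(R\otimes \mathbb{1})(\mathbb{1}\otimes R)(R\otimes\mathbb{1})=(\mathbb{1}\otimes R)(R\otimes\mathbb{1})(\mathbb{1}\otimes R).$$
   Context: Tensor products are over $k$; $\mathbb{1}$ denotes the identity map of $V$. Matrices act on column vectors, so the columns of the matrix of $R$ are the images of the basis vectors. *)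

theory Defs
  imports "HOL-Library.Poly_Mapping" "Jordan_Normal_Form.Matrix"
begin

(* The group algebra of the integers over the rationals, i.e. Q[y, 1/y]: finitely supported
   functions from exponents to coefficients, with convolution as product. *)
type_synonym laurent = "int \<Rightarrow>\<^sub>0 rat"

abbreviation laurent_y :: laurent
  where "laurent_y \<equiv> Poly_Mapping.single 1 1"

lemma laurent_y_times_inverse: "laurent_y * Poly_Mapping.single (-1) 1 = 1"
  by (simp add: Poly_Mapping.mult_single)

class laurent_module = ab_group_add +
  fixes lscale :: "laurent \<Rightarrow> 'a \<Rightarrow> 'a" (infixr \<open>*\<^sub>k\<close> 75)
  assumes lscale_add_right: "c *\<^sub>k (v + w) = c *\<^sub>k v + c *\<^sub>k w"
    and lscale_add_left: "(c + d) *\<^sub>k v = c *\<^sub>k v + d *\<^sub>k v"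
    and lscale_lscale: "c *\<^sub>k d *\<^sub>k v = (c * d) *\<^sub>k v"
    and lscale_one: "1 *\<^sub>k v = v"

global_interpretation lmod: Modules.module "lscale :: laurent \<Rightarrow> 'a \<Rightarrow> 'a::laurent_module"
  by unfold_locales (fact lscale_add_right lscale_add_left lscale_lscale lscale_one)+

abbreviation klinear :: "('a::laurent_module \<Rightarrow> 'b::laurent_module) \<Rightarrow> bool"
  where "klinear \<equiv> Modules.module_hom lscale lscale"

definition ordered_basis :: "'a::laurent_module list \<Rightarrow> bool"
  where "ordered_basis bs \<longleftrightarrow>
    distinct bs \<and> lmod.independent (set bs) \<and> lmod.span (set bs) = UNIV"

(* Column convention: column j holds the coordinates of the image of the j-th basis vector. *)
definition has_matrix :: "'a::laurent_module list \<Rightarrow> laurent mat \<Rightarrow> ('a \<Rightarrow> 'a) \<Rightarrow> bool"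
  where "has_matrix bs A f \<longleftrightarrow>
    klinear f \<and> A \<in> carrier_mat (length bs) (length bs) \<and>
    (\<forall>j<length bs. f (bs ! j) = (\<Sum>i<length bs. A $$ (i, j) *\<^sub>k bs ! i))"

lemma klinearI:
  assumes "\<And>u v. f (u + v) = f u + f v" "\<And>c u. f (c *\<^sub>k u) = c *\<^sub>k f u"
  shows "klinear f"
  by unfold_locales (use assms in auto)


section \<open>Tensor products over the Laurent polynomials\<close>

text \<open>The tensor product is the free module on the set of pairs modulo the submodule
  generated by the bilinearity relations.\<close>

definition free_scale :: "laurent \<Rightarrow> ('x \<Rightarrow>\<^sub>0 laurent) \<Rightarrow> ('x \<Rightarrow>\<^sub>0 laurent)"
  where "free_scale c = Poly_Mapping.map ((*) c)"

lemma lookup_free_scale [simp]: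
  "Poly_Mapping.lookup (free_scale c p) x = c * Poly_Mapping.lookup p x"
  by (simp add: free_scale_def Poly_Mapping.map.rep_eq when_def)

global_interpretation free: Modules.module "free_scale :: laurent \<Rightarrow> ('x \<Rightarrow>\<^sub>0 laurent) \<Rightarrow> _"
  by unfold_locales
    (auto intro!: poly_mapping_eqI simp: Poly_Mapping.lookup_add algebra_simps)

definition tensor_relators ::
    "(('a::laurent_module \<times> 'b::laurent_module) \<Rightarrow>\<^sub>0 laurent) set"
  where "tensor_relators =
    {Poly_Mapping.single (u + u', v) 1 - Poly_Mapping.single (u, v) 1
       - Poly_Mapping.single (u', v) 1 | u u' v. True} \<union>
    {Poly_Mapping.single (u, v + v') 1 - Poly_Mapping.single (u, v) 1
       - Poly_Mapping.single (u, v') 1 | u v v'. True} \<union>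
    {Poly_Mapping.single (c *\<^sub>k u, v) 1 - free_scale c (Poly_Mapping.single (u, v) 1)
       | c u v. True} \<union>
    {Poly_Mapping.single (u, c *\<^sub>k v) 1 - free_scale c (Poly_Mapping.single (u, v) 1)
       | c u v. True}"

definition tensor_rel ::
    "(('a::laurent_module \<times> 'b::laurent_module) \<Rightarrow>\<^sub>0 laurent) \<Rightarrow>
     (('a \<times> 'b) \<Rightarrow>\<^sub>0 laurent) \<Rightarrow> bool"
  where "tensor_rel p q \<longleftrightarrow> p - q \<in> free.span tensor_relators"

quotient_type (overloaded) ('a, 'b) tensor =
  "('a::laurent_module \<times> 'b::laurent_module) \<Rightarrow>\<^sub>0 laurent" / tensor_rel
proof (rule equivpI)
  show "reflp tensor_rel"
    by (simp add: reflp_def tensor_rel_def free.span_zero)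
  show "symp tensor_rel"
    unfolding symp_def tensor_rel_def
    by (metis free.span_neg minus_diff_eq)
  show "transp tensor_rel"
    unfolding tensor_rel_def
    by (intro transpI) (drule (1) free.span_add, simp)
qed

instantiation tensor :: (laurent_module, laurent_module) laurent_module
begin

lift_definition zero_tensor :: "('a, 'b) tensor" is 0 .

lift_definition plus_tensor :: "('a, 'b) tensor \<Rightarrow> ('a, 'b) tensor \<Rightarrow> ('a, 'b) tensor" is "(+)"
  unfolding tensor_rel_def by (simp only: add_diff_add free.span_add)

lift_definition uminus_tensor :: "('a, 'b) tensor \<Rightarrow> ('a, 'b) tensor" is uminus
  unfolding tensor_rel_def by (simp only: minus_diff_minus free.span_neg)

lift_definition minus_tensor :: "('a, 'b) tensor \<Rightarrow> ('a, 'b) tensor \<Rightarrow> ('a, 'b) tensor" is "(-)"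
proof -
  fix p p' q q' :: "('a \<times> 'b) \<Rightarrow>\<^sub>0 laurent"
  assume "tensor_rel p p'" "tensor_rel q q'"
  then have "(p - p') - (q - q') \<in> free.span tensor_relators"
    unfolding tensor_rel_def by (rule free.span_diff)
  then show "tensor_rel (p - q) (p' - q')"
    unfolding tensor_rel_def by (simp add: algebra_simps)
qed

lift_definition lscale_tensor :: "laurent \<Rightarrow> ('a, 'b) tensor \<Rightarrow> ('a, 'b) tensor" is free_scale
  unfolding tensor_rel_def by (simp only: free.scale_right_diff_distrib[symmetric] free.span_scale)

lemma tensor_rel_refl: "p = q \<Longrightarrow> tensor_rel p q"
  by (simp add: tensor_rel_def free.span_zero)

instance
proof
  fix r s t :: "('a, 'b) tensor" and c d :: laurent
  show "r + s + t = r + (s + t)"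
    by transfer (rule tensor_rel_refl, simp add: add.assoc)
  show "r + s = s + r"
    by transfer (rule tensor_rel_refl, simp add: add.commute)
  show "0 + r = r"
    by transfer (rule tensor_rel_refl, simp)
  show "- r + r = 0"
    by transfer (rule tensor_rel_refl, simp)
  show "r - s = r + - s"
    by transfer (rule tensor_rel_refl, simp)
  show "c *\<^sub>k (r + s) = c *\<^sub>k r + c *\<^sub>k s"
    by transfer (rule tensor_rel_refl, simp add: free.scale_right_distrib)
  show "(c + d) *\<^sub>k r = c *\<^sub>k r + d *\<^sub>k r"
    by transfer (rule tensor_rel_refl, simp add: free.scale_left_distrib)
  show "c *\<^sub>k d *\<^sub>k r = (c * d) *\<^sub>k r"
    by transfer (rule tensor_rel_refl, simp)
  show "1 *\<^sub>k r = r"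
    by transfer (rule tensor_rel_refl, simp)
qed

end

lift_definition tensor :: "'a::laurent_module \<Rightarrow> 'b::laurent_module \<Rightarrow> ('a, 'b) tensor"
    (infixr \<open>\<otimes>\<^sub>k\<close> 70)
  is "\<lambda>u v. Poly_Mapping.single (u, v) 1" .

definition bilinear ::
    "('a::laurent_module \<Rightarrow> 'b::laurent_module \<Rightarrow> 'c::laurent_module) \<Rightarrow> bool"
  where "bilinear b \<longleftrightarrow> (\<forall>v. klinear (\<lambda>u. b u v)) \<and> (\<forall>u. klinear (b u))"

(* Meaningful for bilinear b only; existence and uniqueness of h are tensor_universal below. *)
definition tensor_lift ::
    "('a::laurent_module \<Rightarrow> 'b::laurent_module \<Rightarrow> 'c::laurent_module) \<Rightarrow>
     ('a, 'b) tensor \<Rightarrow> 'c"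
  where "tensor_lift b = (THE h. klinear h \<and> (\<forall>u v. h (u \<otimes>\<^sub>k v) = b u v))"

definition tensor_map ::
    "('a::laurent_module \<Rightarrow> 'c::laurent_module) \<Rightarrow> ('b::laurent_module \<Rightarrow> 'd::laurent_module) \<Rightarrow>
     ('a, 'b) tensor \<Rightarrow> ('c, 'd) tensor"
  where "tensor_map f g = tensor_lift (\<lambda>u v. f u \<otimes>\<^sub>k g v)"

(* The canonical isomorphism (u \<otimes> v) \<otimes> w \<mapsto> u \<otimes> (v \<otimes> w), see tensor_assoc_tensor and bij_tensor_assoc. *)
definition tensor_assoc ::
    "(('a::laurent_module, 'b::laurent_module) tensor, 'c::laurent_module) tensor \<Rightarrow>
     ('a, ('b, 'c) tensor) tensor"
  where "tensor_assoc = tensor_lift (\<lambda>t w. tensor_lift (\<lambda>u v. u \<otimes>\<^sub>k (v \<otimes>\<^sub>k w)) t)"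


section \<open>Universal property\<close>

lemma tensor_simps:
  shows "(u + u') \<otimes>\<^sub>k v = u \<otimes>\<^sub>k v + u' \<otimes>\<^sub>k v"
    and "u \<otimes>\<^sub>k (v + v') = u \<otimes>\<^sub>k v + u \<otimes>\<^sub>k v'"
    and "(c *\<^sub>k u) \<otimes>\<^sub>k v = c *\<^sub>k (u \<otimes>\<^sub>k v)"
    and "u \<otimes>\<^sub>k (c *\<^sub>k v) = c *\<^sub>k (u \<otimes>\<^sub>k v)"
  by (transfer, unfold tensor_rel_def, rule free.span_base,
      simp only: tensor_relators_def diff_diff_add[symmetric], blast)+

lemma bilinear_tensor: "bilinear (\<otimes>\<^sub>k)"
  unfolding bilinear_def by (auto intro!: klinearI simp: tensor_simps)

lemma free_span_single: "p \<in> free.span (range (\<lambda>x. Poly_Mapping.single x 1))"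
proof (induction p rule: update_induct)
  case const
  then show ?case by (rule free.span_zero)
next
  case (update f a b)
  have "Poly_Mapping.update a b f = f + free_scale b (Poly_Mapping.single a 1)"
    using update(1)
    by (auto intro!: poly_mapping_eqI
        simp: lookup_update Poly_Mapping.lookup_add lookup_single when_def in_keys_iff)
  then show ?case
    using update by (auto intro!: free.span_add free.span_scale intro: free.span_base)
qed

lemma tensor_span: "lmod.span (range (\<lambda>(u, v). u \<otimes>\<^sub>k v)) = UNIV"
proof -
  have "abs_tensor p \<in> lmod.span (range (\<lambda>(u, v). u \<otimes>\<^sub>k v))" for p :: "('a \<times> 'b) \<Rightarrow>\<^sub>0 laurent"
    using free_span_single[of p]
  proof (induction rule: free.span_induct_alt)
    case base
    have "abs_tensor 0 = (0 :: ('a, 'b) tensor)"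
      by (simp add: zero_tensor_def)
    then show ?case using lmod.span_zero by metis
  next
    case (step c x p)
    then obtain u v where x: "x = Poly_Mapping.single (u, v) 1" by auto
    have "abs_tensor (free_scale c x + p) = c *\<^sub>k (u \<otimes>\<^sub>k v) + abs_tensor p"
      by (simp add: x plus_tensor.abs_eq lscale_tensor.abs_eq tensor.abs_eq)
    then show ?case
      using step by (auto intro!: lmod.span_add lmod.span_scale intro: lmod.span_base)
  qed
  then show ?thesis
    by (metis Quotient_abs_rep Quotient_tensor UNIV_eq_I)
qed

lemma tensor_eqI:
  assumes "klinear f" "klinear g" "\<And>u v. f (u \<otimes>\<^sub>k v) = g (u \<otimes>\<^sub>k v)"
  shows "f = g"
proof
  interpret Modules.module_pair "lscale :: _ \<Rightarrow> ('a, 'b) tensor \<Rightarrow> _" "lscale :: _ \<Rightarrow> 'c \<Rightarrow> _" ..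
  fix t
  show "f t = g t"
    by (rule module_hom_eq_on_span[OF assms(1,2), of "range (\<lambda>(u, v). u \<otimes>\<^sub>k v)"])
      (use assms(3) tensor_span in auto)
qed

definition free_lift :: "('x \<Rightarrow> 'c::laurent_module) \<Rightarrow> ('x \<Rightarrow>\<^sub>0 laurent) \<Rightarrow> 'c"
  where "free_lift b p =
    (\<Sum>x\<in>Poly_Mapping.keys p. Poly_Mapping.lookup p x *\<^sub>k b x)"

lemma free_lift_superset:
  assumes "finite S" "Poly_Mapping.keys p \<subseteq> S"
  shows "free_lift b p = (\<Sum>x\<in>S. Poly_Mapping.lookup p x *\<^sub>k b x)"
  unfolding free_lift_def
  by (rule sum.mono_neutral_left) (use assms in \<open>auto simp: in_keys_iff\<close>)

lemma free_lift_hom: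
  fixes b :: "'x \<Rightarrow> 'c::laurent_module"
  shows "Modules.module_hom free_scale lscale (free_lift b)"
proof unfold_locales
  fix p q :: "'x \<Rightarrow>\<^sub>0 laurent" and c
  let ?S = "Poly_Mapping.keys p \<union> Poly_Mapping.keys q"
  have "free_lift b (p + q) = (\<Sum>x\<in>?S. Poly_Mapping.lookup (p + q) x *\<^sub>k b x)"
    by (rule free_lift_superset) (auto simp: keys_add)
  also have "\<dots> = free_lift b p + free_lift b q"
    by (subst (1 2) free_lift_superset[of ?S])
      (auto simp: Poly_Mapping.lookup_add lmod.scale_left_distrib sum.distrib)
  finally show "free_lift b (p + q) = free_lift b p + free_lift b q" .
  have "free_lift b (free_scale c p) =
      (\<Sum>x\<in>Poly_Mapping.keys p. Poly_Mapping.lookup (free_scale c p) x *\<^sub>k b x)"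
    by (rule free_lift_superset) (auto simp: in_keys_iff)
  then show "free_lift b (free_scale c p) = c *\<^sub>k free_lift b p"
    by (simp add: free_lift_def lmod.scale_sum_right)
qed

lemma free_lift_single [simp]: "free_lift b (Poly_Mapping.single x 1) = b x"
  by (simp add: free_lift_def)

theorem tensor_universal:
  assumes "bilinear b"
  shows "\<exists>!h. klinear h \<and> (\<forall>u v. h (u \<otimes>\<^sub>k v) = b u v)"
proof -
  let ?F = "free_lift (case_prod b)"
  interpret F: Modules.module_hom free_scale lscale ?F by (rule free_lift_hom)
  have L: "Modules.module_hom lscale lscale (\<lambda>u. b u v)" and R: "Modules.module_hom lscale lscale (b u)" for u v
    using assms by (auto simp: bilinear_def)
  have rel: "?F p = 0" if "p \<in> free.span tensor_relators" for p
    using that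
    by (rule F.eq_0_on_span[rotated])
      (auto simp: tensor_relators_def F.diff F.scale
        Modules.module_hom.add[OF L] Modules.module_hom.add[OF R] Modules.module_hom.scale[OF L] Modules.module_hom.scale[OF R])
  have resp: "?F p = ?F q" if "tensor_rel p q" for p q
    using rel[of "p - q"] that by (simp add: tensor_rel_def F.diff)
  define h where "h t = ?F (rep_tensor t)" for t
  have h: "h (abs_tensor p) = ?F p" for p
    unfolding h_def
    by (rule resp) (metis Quotient3_rep_abs Quotient3_tensor tensor_rel_refl)
  have "klinear h"
  proof (rule klinearI)
    fix s t :: "('a, 'b) tensor" and c
    obtain p q where [simp]: "s = abs_tensor p" "t = abs_tensor q"
      by (metis Quotient_abs_rep Quotient_tensor)
    show "h (s + t) = h s + h t"
      by (simp add: plus_tensor.abs_eq h F.add)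
    show "h (c *\<^sub>k s) = c *\<^sub>k h s"
      by (simp add: lscale_tensor.abs_eq h F.scale)
  qed
  moreover have "h (u \<otimes>\<^sub>k v) = b u v" for u v
    by (simp add: tensor.abs_eq h)
  ultimately show ?thesis
    by (intro ex1I[of _ h] tensor_eqI) auto
qed

lemma
  assumes "bilinear b"
  shows klinear_tensor_lift: "klinear (tensor_lift b)"
    and tensor_lift_tensor: "tensor_lift b (u \<otimes>\<^sub>k v) = b u v"
  using theI'[OF tensor_universal[OF assms]] by (auto simp: tensor_lift_def)

lemma
  fixes f :: "'a::laurent_module \<Rightarrow> 'c::laurent_module"
    and g :: "'b::laurent_module \<Rightarrow> 'd::laurent_module"
  assumes "klinear f" "klinear g"
  shows klinear_tensor_map: "klinear (tensor_map f g)"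
    and tensor_map_tensor: "tensor_map f g (u \<otimes>\<^sub>k v) = f u \<otimes>\<^sub>k g v"
proof -
  interpret f: Modules.module_hom lscale lscale f by fact
  interpret g: Modules.module_hom lscale lscale g by fact
  have "bilinear (\<lambda>u v. f u \<otimes>\<^sub>k g v)"
    unfolding bilinear_def
    by (auto intro!: klinearI simp: f.add g.add f.scale g.scale tensor_simps)
  then show "klinear (tensor_map f g)" "tensor_map f g (u \<otimes>\<^sub>k v) = f u \<otimes>\<^sub>k g v"
    by (simp_all add: tensor_map_def klinear_tensor_lift tensor_lift_tensor)
qed

lemma bilinear_tensor_lift:
  assumes "\<And>w. bilinear (\<lambda>u v. b u v w)" "\<And>u v. klinear (b u v)"
  shows "bilinear (\<lambda>t w. tensor_lift (\<lambda>u v. b u v w) t)"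
  unfolding bilinear_def
proof (intro conjI allI)
  note [simp] = tensor_lift_tensor[OF assms(1)]
  note lin = klinear_tensor_lift[OF assms(1)]
  show "klinear (\<lambda>t. tensor_lift (\<lambda>u v. b u v w) t)" for w
    by (rule lin)
  show "klinear (\<lambda>w. tensor_lift (\<lambda>u v. b u v w) t)" for t
  proof (rule klinearI)
    fix w w' c
    have "tensor_lift (\<lambda>u v. b u v (w + w')) =
        (\<lambda>t. tensor_lift (\<lambda>u v. b u v w) t + tensor_lift (\<lambda>u v. b u v w') t)"
      by (rule tensor_eqI, rule lin, rule klinearI)
        (simp_all add: Modules.module_hom.add[OF lin] Modules.module_hom.scale[OF lin]
          lmod.scale_right_distrib mult.commute, rule Modules.module_hom.add[OF assms(2)])
    then show "tensor_lift (\<lambda>u v. b u v (w + w')) t =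
        tensor_lift (\<lambda>u v. b u v w) t + tensor_lift (\<lambda>u v. b u v w') t"
      by (rule fun_cong)
    have "tensor_lift (\<lambda>u v. b u v (c *\<^sub>k w)) = (\<lambda>t. c *\<^sub>k tensor_lift (\<lambda>u v. b u v w) t)"
      by (rule tensor_eqI, rule lin, rule klinearI)
        (simp_all add: Modules.module_hom.add[OF lin] Modules.module_hom.scale[OF lin]
          lmod.scale_right_distrib mult.commute, rule Modules.module_hom.scale[OF assms(2)])
    then show "tensor_lift (\<lambda>u v. b u v (c *\<^sub>k w)) t = c *\<^sub>k tensor_lift (\<lambda>u v. b u v w) t"
      by (rule fun_cong)
  qed
qed

lemma tensor3_eqI_left:
  assumes "klinear f" "klinear g"
    "\<And>u v w. f ((u \<otimes>\<^sub>k v) \<otimes>\<^sub>k w) = g ((u \<otimes>\<^sub>k v) \<otimes>\<^sub>k w)"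
  shows "f = g"
proof (rule tensor_eqI[OF assms(1,2)])
  fix t w
  have "(\<lambda>t. f (t \<otimes>\<^sub>k w)) = (\<lambda>t. g (t \<otimes>\<^sub>k w))"
    by (rule tensor_eqI)
      (auto intro!: klinearI simp: tensor_simps assms(3)
        Modules.module_hom.add[OF assms(1)] Modules.module_hom.scale[OF assms(1)]
        Modules.module_hom.add[OF assms(2)] Modules.module_hom.scale[OF assms(2)])
  then show "f (t \<otimes>\<^sub>k w) = g (t \<otimes>\<^sub>k w)"
    by (rule fun_cong)
qed

lemma tensor3_eqI_right:
  assumes "klinear f" "klinear g"
    "\<And>u v w. f (u \<otimes>\<^sub>k (v \<otimes>\<^sub>k w)) = g (u \<otimes>\<^sub>k (v \<otimes>\<^sub>k w))"
  shows "f = g"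
proof (rule tensor_eqI[OF assms(1,2)])
  fix u t
  have "(\<lambda>t. f (u \<otimes>\<^sub>k t)) = (\<lambda>t. g (u \<otimes>\<^sub>k t))"
    by (rule tensor_eqI)
      (auto intro!: klinearI simp: tensor_simps assms(3)
        Modules.module_hom.add[OF assms(1)] Modules.module_hom.scale[OF assms(1)]
        Modules.module_hom.add[OF assms(2)] Modules.module_hom.scale[OF assms(2)])
  then show "f (u \<otimes>\<^sub>k t) = g (u \<otimes>\<^sub>k t)"
    by (rule fun_cong)
qed

lemma
  fixes u :: "'a::laurent_module" and v :: "'b::laurent_module" and w :: "'c::laurent_module"
  shows klinear_tensor_assoc:
      "klinear (tensor_assoc :: (('a, 'b) tensor, 'c) tensor \<Rightarrow> ('a, ('b, 'c) tensor) tensor)"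
    and tensor_assoc_tensor: "tensor_assoc ((u \<otimes>\<^sub>k v) \<otimes>\<^sub>k w) = u \<otimes>\<^sub>k (v \<otimes>\<^sub>k w)"
proof -
  have b: "bilinear (\<lambda>u v. u \<otimes>\<^sub>k (v \<otimes>\<^sub>k w))" for w :: 'c
    unfolding bilinear_def by (auto intro!: klinearI simp: tensor_simps)
  have "bilinear (\<lambda>t w. tensor_lift (\<lambda>u v. (u::'a) \<otimes>\<^sub>k ((v::'b) \<otimes>\<^sub>k (w::'c))) t)"
    by (rule bilinear_tensor_lift[OF b]) (auto intro!: klinearI simp: tensor_simps)
  from klinear_tensor_lift[OF this] tensor_lift_tensor[OF this]
  show "klinear (tensor_assoc :: (('a, 'b) tensor, 'c) tensor \<Rightarrow> _)"
    and "tensor_assoc ((u \<otimes>\<^sub>k v) \<otimes>\<^sub>k w) = u \<otimes>\<^sub>k (v \<otimes>\<^sub>k w)"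
    by (simp_all only: tensor_assoc_def tensor_lift_tensor[OF b])
qed

lemma bij_tensor_assoc:
  "bij (tensor_assoc :: (('a::laurent_module, 'b::laurent_module) tensor, 'c::laurent_module) tensor \<Rightarrow> _)"
proof -
  define assoc_inv :: "('a, ('b, 'c) tensor) tensor \<Rightarrow> (('a, 'b) tensor, 'c) tensor"
    where "assoc_inv = tensor_lift (\<lambda>u t. tensor_lift (\<lambda>v w. (u \<otimes>\<^sub>k v) \<otimes>\<^sub>k w) t)"
  have b: "bilinear (\<lambda>v w. ((u::'a) \<otimes>\<^sub>k (v::'b)) \<otimes>\<^sub>k (w::'c))" for u
    unfolding bilinear_def by (auto intro!: klinearI simp: tensor_simps)
  have "bilinear (\<lambda>t u. tensor_lift (\<lambda>v w. ((u::'a) \<otimes>\<^sub>k (v::'b)) \<otimes>\<^sub>k (w::'c)) t)"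
    by (rule bilinear_tensor_lift[OF b]) (auto intro!: klinearI simp: tensor_simps)
  then have b': "bilinear (\<lambda>u t. tensor_lift (\<lambda>v w. ((u::'a) \<otimes>\<^sub>k (v::'b)) \<otimes>\<^sub>k (w::'c)) t)"
    by (simp add: bilinear_def)
  have assoc_inv: "klinear assoc_inv" "assoc_inv (u \<otimes>\<^sub>k (v \<otimes>\<^sub>k w)) = (u \<otimes>\<^sub>k v) \<otimes>\<^sub>k w" for u v w
    using klinear_tensor_lift[OF b'] tensor_lift_tensor[OF b']
    by (simp_all add: assoc_inv_def tensor_lift_tensor[OF b])
  have "assoc_inv \<circ> tensor_assoc = id"
    by (rule tensor3_eqI_left)
      (auto intro!: module_hom_compose[OF klinear_tensor_assoc assoc_inv(1)] klinearI
        simp: tensor_assoc_tensor assoc_inv(2))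
  moreover have "tensor_assoc \<circ> assoc_inv = id"
    by (rule tensor3_eqI_right)
      (auto intro!: module_hom_compose[OF assoc_inv(1) klinear_tensor_assoc] klinearI
        simp: tensor_assoc_tensor assoc_inv(2))
  ultimately show ?thesis
    by (rule o_bij)
qed

lemma has_matrix_tensor_exists:
  assumes basis: "ordered_basis [e1, e2]" and A: "A \<in> carrier_mat 4 4"
  shows "\<exists>R. has_matrix [e1 \<otimes>\<^sub>k e1, e1 \<otimes>\<^sub>k e2, e2 \<otimes>\<^sub>k e1, e2 \<otimes>\<^sub>k e2] A R"
proof -
  define bs where "bs = [e1 \<otimes>\<^sub>k e1, e1 \<otimes>\<^sub>k e2, e2 \<otimes>\<^sub>k e1, e2 \<otimes>\<^sub>k e2]"
  define col where "col j = (\<Sum>i<4. A $$ (i, j) *\<^sub>k bs ! i)" for j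
  define x where "x v e = lmod.representation {e1, e2} v e" for v e
  have ind: "lmod.independent {e1, e2}" and ne: "e1 \<noteq> e2" and sp: "v \<in> lmod.span {e1, e2}" for v
    using basis by (auto simp: ordered_basis_def)
  have x_add: "x (v + w) e = x v e + x w e" for v w e
    unfolding x_def by (subst lmod.representation_add[OF ind sp sp]) simp
  have x_scale: "x (c *\<^sub>k v) e = c * x v e" for c v e
    unfolding x_def by (subst lmod.representation_scale[OF ind sp]) simp
  have x_basis: "x e1 e1 = 1" "x e1 e2 = 0" "x e2 e1 = 0" "x e2 e2 = 1"
    using ne by (simp_all add: x_def lmod.representation_basis[OF ind])
  define b where "b u v =
    (x u e1 * x v e1) *\<^sub>k col 0 + (x u e1 * x v e2) *\<^sub>k col 1 +
    (x u e2 * x v e1) *\<^sub>k col 2 + (x u e2 * x v e2) *\<^sub>k col 3" for u v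
  have b: "bilinear b"
    unfolding bilinear_def b_def
    by (auto intro!: klinearI simp: x_add x_scale lmod.scale_left_distrib
        lmod.scale_right_distrib distrib_left distrib_right mult_ac add_ac)
  have "tensor_lift b (bs ! j) = col j" if "j < 4" for j
    using that tensor_lift_tensor[OF b]
    by (auto simp: bs_def b_def x_basis numeral_eq_Suc less_Suc_eq)
  moreover have "length bs = 4"
    by (simp add: bs_def)
  ultimately have "has_matrix bs A (tensor_lift b)"
    using A klinear_tensor_lift[OF b] by (simp add: has_matrix_def col_def)
  then show ?thesis unfolding bs_def by blast
qed

end

theory Submission
  imports Defs
begin

text \<open>Both sides are linear, so it suffices to compare them on the eight tensors e_i \<otimes>
  (e_j \<otimes> e_k), which span the triple product; \<open>tensor3_eqI_on_span\<close> makes this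
  reduction. R preserves the number of factors \<open>e2\<close>. It fixes the tensors with all
  factors equal. On each of the two remaining weight spaces, of rank 3, the operators R \<otimes> 1
  and 1 \<otimes> R act by the transposed Burau matrices of the braid group on three strands with
  parameter y^2, so the equation is the braid relation; here it is checked on each basis tensor.
  Triple products are bracketed to the right, so R \<otimes> 1 is conjugated by the associator,
  whose inverse has to be linear (\<open>klinear_inv_tensor_assoc\<close>).\<close>

text \<open>Pure tensors span, and bilinearity expands a pure tensor one factor at a time: the
  second factor over \<open>B\<close> while the first stays in \<open>A\<close>, then the first over
  \<open>A\<close>.\<close>

lemma tensor_span_of_spans:
  fixes A :: "'a::laurent_module set" and B :: "'b::laurent_module set"
  assumes "lmod.span A = UNIV" "lmod.span B = UNIV"
  shows "lmod.span ((\<lambda>(u, v). u \<otimes>\<^sub>k v) ` (A \<times> B)) = UNIV"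
proof -
  let ?S = "lmod.span ((\<lambda>(u, v). u \<otimes>\<^sub>k v) ` (A \<times> B))"
  have left: "klinear (\<lambda>u. u \<otimes>\<^sub>k v)" and right: "klinear (\<lambda>v. u \<otimes>\<^sub>k v)"
    for u :: 'a and v :: 'b
    using bilinear_tensor by (auto simp: bilinear_def)
  have A_mem: "u \<otimes>\<^sub>k v \<in> ?S" if "u \<in> A" for u v
  proof -
    have "v \<in> lmod.span B" using assms by simp
    then show ?thesis
      by (induction rule: lmod.span_induct_alt)
        (use that in \<open>auto simp: tensor_simps Modules.module_hom.zero[OF right]
          intro!: lmod.span_zero lmod.span_add lmod.span_scale intro: lmod.span_base\<close>)
  qed
  have "u \<otimes>\<^sub>k v \<in> ?S" for u v
  proof -
    have "u \<in> lmod.span A" using assms by simp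
    then show ?thesis
      by (induction rule: lmod.span_induct_alt)
        (auto simp: tensor_simps Modules.module_hom.zero[OF left]
          intro!: lmod.span_zero lmod.span_add lmod.span_scale A_mem)
  qed
  then have "lmod.span (range (\<lambda>(u, v). u \<otimes>\<^sub>k v)) \<subseteq> ?S"
    by (intro lmod.span_minimal) auto
  then show ?thesis
    using tensor_span by blast
qed

text \<open>Applying \<open>tensor_span_of_spans\<close> twice, to the inner and then to the outer
  product, shows that the tested tensors span.\<close>

lemma tensor3_eqI_on_span:
  fixes f g :: "('a::laurent_module, ('b::laurent_module, 'c::laurent_module) tensor) tensor
    \<Rightarrow> 'd::laurent_module"
  assumes "klinear f" "klinear g"
    and "lmod.span A = UNIV" "lmod.span B = UNIV" "lmod.span C = UNIV"
    and "\<And>u v w. u \<in> A \<Longrightarrow> v \<in> B \<Longrightarrow> w \<in> C \<Longrightarrow>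
      f (u \<otimes>\<^sub>k (v \<otimes>\<^sub>k w)) = g (u \<otimes>\<^sub>k (v \<otimes>\<^sub>k w))"
  shows "f = g"
proof
  interpret Modules.module_pair
    "lscale :: _ \<Rightarrow> ('a, ('b, 'c) tensor) tensor \<Rightarrow> _" "lscale :: _ \<Rightarrow> 'd \<Rightarrow> _" ..
  fix t
  let ?BC = "(\<lambda>(v, w). v \<otimes>\<^sub>k w) ` (B \<times> C)"
  have span: "lmod.span ((\<lambda>(u, s). u \<otimes>\<^sub>k s) ` (A \<times> ?BC)) = UNIV"
    by (intro tensor_span_of_spans assms)
  show "f t = g t"
    by (rule module_hom_eq_on_span[OF assms(1,2), of "(\<lambda>(u, s). u \<otimes>\<^sub>k s) ` (A \<times> ?BC)"])
      (use span assms(6) in auto)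
qed

lemma inv_tensor_assoc_tensor:
  "inv_into UNIV tensor_assoc (u \<otimes>\<^sub>k (v \<otimes>\<^sub>k w)) = (u \<otimes>\<^sub>k v) \<otimes>\<^sub>k w"
  by (metis tensor_assoc_tensor bij_tensor_assoc bij_inv_eq_iff)

lemma klinear_inv_tensor_assoc: "klinear (inv_into UNIV tensor_assoc)"
proof (rule klinearI)
  note inv_eq = bij_inv_eq_iff[OF bij_tensor_assoc]
  note inv_right = surj_f_inv_f[OF bij_is_surj[OF bij_tensor_assoc]]
  show "inv_into UNIV tensor_assoc (s + t) = inv_into UNIV tensor_assoc s + inv_into UNIV tensor_assoc t" for s t
    \<comment> \<open>\<open>inv_eq\<close> needs the inverse alone on the right; it then moves the
      claim to the image under \<open>tensor_assoc\<close>, where linearity is known.\<close>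
    by (rule sym, simp add: inv_eq inv_right Modules.module_hom.add[OF klinear_tensor_assoc])
  show "inv_into UNIV tensor_assoc (c *\<^sub>k s) = c *\<^sub>k inv_into UNIV tensor_assoc s" for c s
    by (rule sym, simp add: inv_eq inv_right Modules.module_hom.scale[OF klinear_tensor_assoc])
qed

theorem theorem3p5:
  fixes e1 e2 :: "'v::laurent_module"
    and R :: "('v, 'v) tensor \<Rightarrow> ('v, 'v) tensor"
  assumes "ordered_basis [e1, e2]"
    and "has_matrix [e1 \<otimes>\<^sub>k e1, e1 \<otimes>\<^sub>k e2, e2 \<otimes>\<^sub>k e1, e2 \<otimes>\<^sub>k e2]
      (mat_of_rows_list 4
        [[1, 0, 0, 0],
         [0, 1 - laurent_y\<^sup>2, 1, 0],
         [0, laurent_y\<^sup>2, 0, 0],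
         [0, 0, 0, 1]]) R"
  shows "let R12 = tensor_assoc \<circ> tensor_map R (id :: 'v \<Rightarrow> 'v) \<circ> inv_into UNIV tensor_assoc;
             R23 = tensor_map (id :: 'v \<Rightarrow> 'v) R
         in R12 \<circ> R23 \<circ> R12 = R23 \<circ> R12 \<circ> R23"
proof -
  \<comment> \<open>Only the commutative ring laws matter from here on, so y^2 is hidden behind an
    opaque name.\<close>
  define q where "q = laurent_y\<^sup>2"
  have R: "klinear R" and idlin: "klinear (id :: 'v \<Rightarrow> 'v)"
    using assms(2) by (auto simp: has_matrix_def intro: klinearI)
  let ?bs = "[e1 \<otimes>\<^sub>k e1, e1 \<otimes>\<^sub>k e2, e2 \<otimes>\<^sub>k e1, e2 \<otimes>\<^sub>k e2]"
  let ?A = "mat_of_rows_list 4 [[1, 0, 0, 0], [0, 1 - q, 1, 0], [0, q, 0, 0], [0, 0, 0, 1]]"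
  have col: "\<forall>j<length ?bs. R (?bs ! j) = (\<Sum>i<length ?bs. ?A $$ (i, j) *\<^sub>k ?bs ! i)"
    using assms(2) unfolding has_matrix_def q_def by blast
  \<comment> \<open>The four columns of the matrix, with zero entries dropped.\<close>
  have R_basis: "R (e1 \<otimes>\<^sub>k e1) = e1 \<otimes>\<^sub>k e1"
    "R (e1 \<otimes>\<^sub>k e2) = (1 - q) *\<^sub>k (e1 \<otimes>\<^sub>k e2) + q *\<^sub>k (e2 \<otimes>\<^sub>k e1)"
    "R (e2 \<otimes>\<^sub>k e1) = e1 \<otimes>\<^sub>k e2"
    "R (e2 \<otimes>\<^sub>k e2) = e2 \<otimes>\<^sub>k e2"
    using col[rule_format, of 0] col[rule_format, of 1] col[rule_format, of 2]
      col[rule_format, of 3]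
    by (simp_all add: mat_of_rows_list_def numeral_eq_Suc)
  define R12 where "R12 = tensor_assoc \<circ> tensor_map R (id :: 'v \<Rightarrow> 'v) \<circ> inv_into UNIV tensor_assoc"
  define R23 where "R23 = tensor_map (id :: 'v \<Rightarrow> 'v) R"
  have lin12: "klinear R12"
    unfolding R12_def
    by (rule module_hom_compose[OF klinear_inv_tensor_assoc
          module_hom_compose[OF klinear_tensor_map[OF R idlin] klinear_tensor_assoc],
          folded comp_assoc])
  have lin23: "klinear R23"
    unfolding R23_def by (intro klinear_tensor_map R idlin)
  interpret R12: Modules.module_hom lscale lscale R12 by (fact lin12)
  interpret R23: Modules.module_hom lscale lscale R23 by (fact lin23)
  interpret assoc: Modules.module_hom lscale lscale
    "tensor_assoc :: (('v, 'v) tensor, 'v) tensor \<Rightarrow> _" by (fact klinear_tensor_assoc)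
  \<comment> \<open>The associator stays in place: it can be evaluated only once R (u \<otimes> v)
    is written as a sum of pure tensors.\<close>
  have R12_tensor: "R12 (u \<otimes>\<^sub>k (v \<otimes>\<^sub>k w)) = tensor_assoc (R (u \<otimes>\<^sub>k v) \<otimes>\<^sub>k w)" for u v w
    by (simp add: R12_def inv_tensor_assoc_tensor tensor_map_tensor[OF R idlin])
  have R23_tensor: "R23 (u \<otimes>\<^sub>k t) = u \<otimes>\<^sub>k R t" for u t
    by (simp add: R23_def tensor_map_tensor[OF idlin R])
  have span: "lmod.span {e1, e2} = UNIV"
    using assms(1) by (simp add: ordered_basis_def)
  have "R12 \<circ> R23 \<circ> R12 = R23 \<circ> R12 \<circ> R23"
  proof (rule tensor3_eqI_on_span[OF _ _ span span span])
    show "klinear (R12 \<circ> R23 \<circ> R12)" "klinear (R23 \<circ> R12 \<circ> R23)"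
      by (rule module_hom_compose[OF _ module_hom_compose], fact+)+
    show "(R12 \<circ> R23 \<circ> R12) (u \<otimes>\<^sub>k (v \<otimes>\<^sub>k w)) = (R23 \<circ> R12 \<circ> R23) (u \<otimes>\<^sub>k (v \<otimes>\<^sub>k w))"
      if "u \<in> {e1, e2}" "v \<in> {e1, e2}" "w \<in> {e1, e2}" for u v w
      \<comment> \<open>Eight cases: the first simplification pushes both sides down to combinations
        of basis tensors, the second compares the coefficients as polynomials in
        \<open>q\<close>.\<close>
      using that
      by (elim insertE emptyE; hypsubst;
          simp only: o_apply R12_tensor R23_tensor R_basis tensor_simps tensor_assoc_tensor
            R12.add R12.scale R23.add R23.scale assoc.add assoc.scale;
          simp add: algebra_simps lmod.scale_left_diff_distrib lmod.scale_right_diff_distrib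
            lmod.scale_right_distrib)
  qed
  then show ?thesis
    by (simp add: R12_def R23_def Let_def)
qed

end
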